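(* Let $2\le p\le 9$ be an integer, let $T_1,T_2,\Delta t>0$ and $\Omega\in\mathbb{R}$. Consider the $p$-th order Gregory nested Picard iteration scheme (without trace renormalization) applied to the single-qubit Lindblad test equation, with flow-operator approximation $U^{(p)}(t^{n+k},t^n)=\mathrm{diag}(1,\varsigma^{(p)}(k))$, where all these objects and the notion of stability are defined in the context. Set $$B^{(p)}=\sum_{k=0}^{p-1}\bigl(\omega^{(p)}_{2p-3}\bigr)^k\left(\frac{\Delta t}{T_2}\right)^k .$$ If all roots $\lambda\in\mathbb{C}$ of the polynomial of degree $2p-3$ $$\lambda^{2p-3}-\sum_{k=1}^{2p-3}\lambda^{2p-3-k}\,\omega^{(p)}_{2p-3-k}\,B^{(p)}\,\frac{\Delta t}{T_2}\left|\varsigma^{(p)}(k)\right|^2-\lambda^{2p-4}\bigl(\omega^{(p)}_{2p-3}\bigr)^p\left(\frac{\Delta t}{T_2}\right)^p-B^{(p)}\left|\varsigma^{(p)}(2p-3)\right|^2$$ lie in the unit disk $\{|\lambda|\le1\}$, and $$\left|\varsigma^{(p)}(2p-3)\right|\le1,$$ then the $p$-th order scheme is stable.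
   Context: Test equation: $\rho(t)\in\mathbb{C}^{2\times 2}$ satisfies the Lindblad equation $\rho'=J\rho+\rho J^\dagger+\mathcal{L}_L\rho$, where $\mathcal{L}_L\rho=\mathcal{L}_1\rho\mathcal{L}_1^\dagger+\mathcal{L}_2\rho\mathcal{L}_2^\dagger$, $^\dagger$ is the conjugate transpose, $$H=\Omega\begin{pmatrix}0&0\\0&1\end{pmatrix},\quad \mathcal{L}_1=\frac{1}{\sqrt{T_1}}\begin{pmatrix}0&1\\0&0\end{pmatrix},\quad \mathcal{L}_2=\frac{1}{\sqrt{T_2}}\begin{pmatrix}0&0\\0&1\end{pmatrix},$$ $$J=-iH-\tfrac12\mathcal{L}_1^\dagger\mathcal{L}_1-\tfrac12\mathcal{L}_2^\dagger\mathcal{L}_2=\begin{pmatrix}0&0\\0&-i\Omega-\frac{1}{2T_1}-\frac{1}{2T_2}\end{pmatrix}.$$ Time grid: $t^n=n\Delta t$. Write $N=2p-3$. Gregory weights: the scheme of order $p$ uses $N+1=2p-2$ positive weights $\omega^{(p)}_0,\dots,\omega^{(p)}_{N}$, symmetric in the sense $\omega^{(p)}_j=\omega^{(p)}_{N-j}$. The first $p-1$ of them, $\omega^{(p)}_0,\dots,\omega^{(p)}_{p-2}$, are: $p=2$: $\frac12$. $p=3$: $\frac5{12},\frac{13}{12}$. $p=4$: $\frac38,\frac76,\frac{23}{24}$. $p=5$: $\frac{251}{720},\frac{299}{240},\frac{211}{240},\frac{739}{720}$. $p=6$: $\frac{95}{288},\frac{317}{240},\frac{23}{30},\frac{793}{720},\frac{157}{160}$.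 $p=7$: $\frac{19087}{60480},\frac{84199}{60480},\frac{18869}{30240},\frac{37621}{30240},\frac{55031}{60480},\frac{61343}{60480}$. $p=8$: $\frac{5257}{17280},\frac{22081}{15120},\frac{54851}{120960},\frac{103}{70},\frac{89437}{120960},\frac{16367}{15120},\frac{23917}{24192}$. $p=9$: $\frac{1070017}{3628800},\frac{5537111}{3628800},\frac{103613}{403200},\frac{261115}{145152},\frac{298951}{725760},\frac{515677}{403200},\frac{3349879}{3628800},\frac{3662753}{3628800}$. Flow operator: $U^{(p)}(t^{n+k},t^n)$, $k\ge1$, is a (explicit or implicit) $p$-th order approximation of the flow of $V'=JV$ over $[t^n,t^{n+k}]$. It has the form $U^{(p)}(t^{n+k},t^n)=\mathrm{diag}(1,\varsigma^{(p)}(k))$, where $\varsigma^{(p)}(k)\in\mathbb{C}$ depends only on $k$ and on $\Delta t\,\Omega$, $\Delta t/T_1$, $\Delta t/T_2$, and on the chosen approximation (not on $n$). $p$-th order scheme: given $\rho^n,\dots,\rho^{n+N-1}$, set $\rho^{n+N,0}=\rho^{n+N-1}$ and, for $k=1,\dots,p$, $$\rho^{n+N,k}=U^{(p)}(t^{n+N},t^n)\rho^nU^{(p)}(t^{n+N},t^n)^\dagger+\Delta t\sum_{j=0}^{N-1}\omega^{(p)}_jU^{(p)}(t^{n+N},t^{n+j})\bigl(\mathcal{L}_L\rho^{n+j}\bigr)U^{(p)}(t^{n+N},t^{n+j})^\dagger+\Delta t\,\omega^{(p)}_{N}\mathcal{L}_L\rho^{n+N,k-1},$$ and define $\rho^{n+N}=\rho^{n+N,p}$.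 No trace renormalization is applied. Stability: the scheme defines a linear map $(\rho^{n+N-1},\dots,\rho^{n})\mapsto(\rho^{n+N},\dots,\rho^{n+1})$ on $(\mathbb{C}^{2\times2})^{N}$. Its matrix (after vectorizing) is the amplification matrix. The scheme is called stable if the spectral radius of the amplification matrix is at most $1$, i.e. all of its eigenvalues have modulus $\le1$. *)

theory Defs
  imports
    "Jordan_Normal_Form.Spectral_Radius"
    "HOL-Analysis.Analysis"
    "HOL-Library.Landau_Symbols"
begin

no_notation vec_index (infixl "$" 100)

section \<open>The test equation\<close>

definition dagger :: "complex^2^2 \<Rightarrow> complex^2^2" where
  "dagger A = (\<chi> i j. cnj (A $ j $ i))"

definition mat2 :: "complex \<Rightarrow> complex \<Rightarrow> complex \<Rightarrow> complex \<Rightarrow> complex^2^2" where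
  "mat2 a b c d = vector [vector [a, b], vector [c, d]]"

definition lindblad_H :: "real \<Rightarrow> complex^2^2" where
  "lindblad_H \<Omega> = \<Omega> *\<^sub>R mat2 0 0 0 1"

definition lindblad_L1 :: "real \<Rightarrow> complex^2^2" where
  "lindblad_L1 T1 = (1 / sqrt T1) *\<^sub>R mat2 0 1 0 0"

definition lindblad_L2 :: "real \<Rightarrow> complex^2^2" where
  "lindblad_L2 T2 = (1 / sqrt T2) *\<^sub>R mat2 0 0 0 1"

definition lindblad_J :: "real \<Rightarrow> real \<Rightarrow> real \<Rightarrow> complex^2^2" where
  "lindblad_J \<Omega> T1 T2 = mat (- \<i>) ** lindblad_H \<Omega>
     - (1/2) *\<^sub>R (dagger (lindblad_L1 T1) ** lindblad_L1 T1)
     - (1/2) *\<^sub>R (dagger (lindblad_L2 T2) ** lindblad_L2 T2)"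

lemma mat2_nth:
  "mat2 a b c d = (\<chi> i j. if i = 1 then (if j = 1 then a else b) else (if j = 1 then c else d))"
  by (simp add: mat2_def vec_eq_iff forall_2 vector_def)

lemma lindblad_J_eq:
  assumes "T1 > 0" and "T2 > 0"
  shows "lindblad_J \<Omega> T1 T2 = mat2 0 0 0 (- \<i> * \<Omega> - 1 / (2 * T1) - 1 / (2 * T2))"
  using assms
  by (simp add: mat2_nth lindblad_J_def lindblad_H_def lindblad_L1_def lindblad_L2_def dagger_def
      matrix_matrix_mult_def vec_eq_iff forall_2 sum_2 mat_def complex_eq_iff)

definition jump :: "real \<Rightarrow> real \<Rightarrow> complex^2^2 \<Rightarrow> complex^2^2" where
  "jump T1 T2 \<rho> = lindblad_L1 T1 ** \<rho> ** dagger (lindblad_L1 T1)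
     + lindblad_L2 T2 ** \<rho> ** dagger (lindblad_L2 T2)"

section \<open>Gregory weights\<close>

definition gregory_half :: "nat \<Rightarrow> real list" where
  "gregory_half p =
    (if p = 2 then [1/2]
     else if p = 3 then [5/12, 13/12]
     else if p = 4 then [3/8, 7/6, 23/24]
     else if p = 5 then [251/720, 299/240, 211/240, 739/720]
     else if p = 6 then [95/288, 317/240, 23/30, 793/720, 157/160]
     else if p = 7 then [19087/60480, 84199/60480, 18869/30240, 37621/30240,
                         55031/60480, 61343/60480]
     else if p = 8 then [5257/17280, 22081/15120, 54851/120960, 103/70,
                         89437/120960, 16367/15120, 23917/24192]
     else if p = 9 then [1070017/3628800, 5537111/3628800, 103613/403200, 261115/145152,
                         298951/725760, 515677/403200, 3349879/3628800, 3662753/3628800]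
     else [])"

text \<open>The tabulated values are the weights of index \<open>0, \<dots>, p - 2\<close>; the remaining ones, of
  index \<open>p - 1, \<dots>, 2 * p - 3\<close>, are given by symmetry.\<close>

definition gregory_weight :: "nat \<Rightarrow> nat \<Rightarrow> real" where
  "gregory_weight p j = gregory_half p ! (if j \<le> p - 2 then j else 2 * p - 3 - j)"

section \<open>The flow operator\<close>

text \<open>\<open>flow_op \<sigma> m n\<close> stands for $U(t^m, t^n)$, with \<open>n < m\<close>.\<close>

definition flow_op :: "(nat \<Rightarrow> complex) \<Rightarrow> nat \<Rightarrow> nat \<Rightarrow> complex^2^2" where
  "flow_op \<sigma> m n = mat2 1 0 0 (\<sigma> (m - n))"

definition is_flow :: "complex^2^2 \<Rightarrow> (real \<Rightarrow> complex^2^2) \<Rightarrow> bool" where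
  "is_flow A \<Phi> \<longleftrightarrow> \<Phi> 0 = mat 1 \<and> (\<forall>t. (\<Phi> has_vector_derivative A ** \<Phi> t) (at t))"

text \<open>The arguments of \<open>s\<close> are the number of time steps and the three dimensionless quantities
  $\Delta t\,\Omega$, $\Delta t/T_1$, $\Delta t/T_2$. Order \<open>p\<close> is meant in the usual sense of
  one-step methods: the error over a fixed number of steps is $O(\Delta t^{p+1})$.\<close>

definition flow_approximation ::
    "nat \<Rightarrow> (nat \<Rightarrow> real \<Rightarrow> real \<Rightarrow> real \<Rightarrow> complex) \<Rightarrow> bool" where
  "flow_approximation p s \<longleftrightarrow>
     (\<forall>\<Omega> T1 T2. \<forall>k\<ge>1. T1 > 0 \<longrightarrow> T2 > 0 \<longrightarrow>
        (\<exists>\<Phi>. is_flow (lindblad_J \<Omega> T1 T2) \<Phi> \<and>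
          (\<forall>n. (\<lambda>\<Delta>t. norm (flow_op (\<lambda>l. s l (\<Delta>t * \<Omega>) (\<Delta>t / T1) (\<Delta>t / T2)) (n + k) n
                        - \<Phi> (real k * \<Delta>t)))
               \<in> O[at_right 0](\<lambda>\<Delta>t. \<Delta>t ^ (p + 1)))))"

section \<open>The scheme\<close>

text \<open>\<open>picard p T1 T2 \<Delta>t \<sigma> \<rho> n k\<close> is $\rho^{n+N,k}$ with $N = 2p-3$; it only uses
  \<open>\<rho> n, \<dots>, \<rho> (n + N - 1)\<close>.\<close>

primrec picard :: "nat \<Rightarrow> real \<Rightarrow> real \<Rightarrow> real \<Rightarrow> (nat \<Rightarrow> complex) \<Rightarrow> (nat \<Rightarrow> complex^2^2) \<Rightarrow>
    nat \<Rightarrow> nat \<Rightarrow> complex^2^2" where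
  "picard p T1 T2 \<Delta>t \<sigma> \<rho> n 0 = \<rho> (n + (2 * p - 3) - 1)"
| "picard p T1 T2 \<Delta>t \<sigma> \<rho> n (Suc k) =
     (let N = 2 * p - 3 in
        flow_op \<sigma> (n + N) n ** \<rho> n ** dagger (flow_op \<sigma> (n + N) n)
      + \<Delta>t *\<^sub>R (\<Sum>j<N. gregory_weight p j *\<^sub>R
          (flow_op \<sigma> (n + N) (n + j) ** jump T1 T2 (\<rho> (n + j))
             ** dagger (flow_op \<sigma> (n + N) (n + j))))
      + (\<Delta>t * gregory_weight p N) *\<^sub>R jump T1 T2 (picard p T1 T2 \<Delta>t \<sigma> \<rho> n k))"

text \<open>A state is a window of $N = 2p-3$ matrices, represented by a function on \<open>nat\<close> of which
  only the values at \<open>0, \<dots>, N - 1\<close> matter; \<open>\<rho> j\<close> stands for $\rho^{n+j}$.\<close>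

definition scheme_step :: "nat \<Rightarrow> real \<Rightarrow> real \<Rightarrow> real \<Rightarrow> (nat \<Rightarrow> complex) \<Rightarrow>
    (nat \<Rightarrow> complex^2^2) \<Rightarrow> nat \<Rightarrow> complex^2^2" where
  "scheme_step p T1 T2 \<Delta>t \<sigma> \<rho> j =
     (if j + 1 < 2 * p - 3 then \<rho> (j + 1) else picard p T1 T2 \<Delta>t \<sigma> \<rho> 0 p)"

section \<open>Amplification matrix and stability\<close>

text \<open>Windows of length \<open>N\<close> are vectorized from the newest entry to the oldest one, each matrix
  being stacked column by column.\<close>

definition ix :: "nat \<Rightarrow> 2" where
  "ix i = (if i = 0 then 1 else 2)"

definition vectorize :: "nat \<Rightarrow> (nat \<Rightarrow> complex^2^2) \<Rightarrow> complex Matrix.vec" where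
  "vectorize N \<rho> = Matrix.vec (4 * N)
     (\<lambda>r. \<rho> (N - 1 - r div 4) $ ix (r mod 2) $ ix (r mod 4 div 2))"

definition unvectorize :: "nat \<Rightarrow> complex Matrix.vec \<Rightarrow> nat \<Rightarrow> complex^2^2" where
  "unvectorize N v j =
     (let b = 4 * (N - 1 - j) in
      mat2 (vec_index v b) (vec_index v (b + 2)) (vec_index v (b + 1)) (vec_index v (b + 3)))"

definition amplification_matrix :: "nat \<Rightarrow> real \<Rightarrow> real \<Rightarrow> real \<Rightarrow> (nat \<Rightarrow> complex) \<Rightarrow>
    complex Matrix.mat" where
  "amplification_matrix p T1 T2 \<Delta>t \<sigma> =
     (let N = 2 * p - 3 in
      mat_of_cols (4 * N)
        (map (\<lambda>c. vectorize N (scheme_step p T1 T2 \<Delta>t \<sigma> (unvectorize N (unit_vec (4 * N) c))))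
          [0..<4 * N]))"

definition scheme_stable :: "nat \<Rightarrow> real \<Rightarrow> real \<Rightarrow> real \<Rightarrow> (nat \<Rightarrow> complex) \<Rightarrow> bool" where
  "scheme_stable p T1 T2 \<Delta>t \<sigma> \<longleftrightarrow> spectral_radius (amplification_matrix p T1 T2 \<Delta>t \<sigma>) \<le> 1"

section \<open>The stability polynomial\<close>

definition picard_factor :: "nat \<Rightarrow> real \<Rightarrow> real \<Rightarrow> real" where
  "picard_factor p T2 \<Delta>t = (\<Sum>k=0..p-1. gregory_weight p (2*p-3) ^ k * (\<Delta>t / T2) ^ k)"

definition stability_poly :: "nat \<Rightarrow> real \<Rightarrow> real \<Rightarrow> (nat \<Rightarrow> complex) \<Rightarrow> complex poly" where
  "stability_poly p T2 \<Delta>t \<sigma> =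
     monom 1 (2*p-3)
     - (\<Sum>k=1..2*p-3. monom (complex_of_real
          (gregory_weight p (2*p-3-k) * picard_factor p T2 \<Delta>t * (\<Delta>t / T2) * (cmod (\<sigma> k))\<^sup>2))
          (2*p-3-k))
     - monom (complex_of_real (gregory_weight p (2*p-3) ^ p * (\<Delta>t / T2) ^ p)) (2*p-4)
     - [: complex_of_real (picard_factor p T2 \<Delta>t * (cmod (\<sigma> (2*p-3)))\<^sup>2) :]"

end

theory Submission
  imports Defs
begin

text \<open>The jump term and conjugation by a diagonal flow operator act on the four entries of a
  density matrix almost independently: the jump term only reads the entry \<open>(2, 2)\<close>. Hence the
  recursion for the entry \<open>(2, 2)\<close> is closed (\<open>picard_22\<close>), each off-diagonal entry evolves by
  a single multiplication with \<open>\<sigma> N\<close>, \<open>N = 2 * p - 3\<close>, or its conjugate, and the entry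
  \<open>(1, 1)\<close> is copied from the oldest matrix up to a source built from the entries \<open>(2, 2)\<close>.

  An eigenvector of the amplification matrix with eigenvalue \<open>\<lambda>\<close> is a window
  $\rho^0, \lambda\rho^0, \dots, \lambda^{N-1}\rho^0$ whose successor is $\lambda^N\rho^0$
  (\<open>eigenvector_window\<close>), and $\rho^0 \neq 0$. If the entry \<open>(2, 2)\<close> of $\rho^0$
  is nonzero, dividing by it turns the recursion for that entry into the stability polynomial,
  evaluated at \<open>\<lambda>\<close>. Otherwise the source in the entry \<open>(1, 1)\<close> is absent, and a nonzero entry
  forces $\lambda^N$ to be one of \<open>1\<close>, \<open>\<sigma> N\<close>, \<open>cnj (\<sigma> N)\<close>, all of modulus at most \<open>1\<close>.\<close>

section \<open>The scheme entry by entry\<close>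

lemma mat2_entries [simp]:
  "mat2 a b c d $ 1 $ 1 = a" "mat2 a b c d $ 1 $ 2 = b"
  "mat2 a b c d $ 2 $ 1 = c" "mat2 a b c d $ 2 $ 2 = d"
  by (simp_all add: mat2_nth)

lemma matrix_2_eq_iff:
  fixes A B :: "'a^2^2"
  shows "A = B \<longleftrightarrow> A $ 1 $ 1 = B $ 1 $ 1 \<and> A $ 1 $ 2 = B $ 1 $ 2 \<and>
                  A $ 2 $ 1 = B $ 2 $ 1 \<and> A $ 2 $ 2 = B $ 2 $ 2"
  by (auto simp: vec_eq_iff forall_2)

lemma jump_eq:
  assumes "T1 > 0" and "T2 > 0"
  shows "jump T1 T2 \<rho> = mat2 (\<rho> $ 2 $ 2 / T1) 0 0 (\<rho> $ 2 $ 2 / T2)"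
  using assms
  by (simp add: jump_def matrix_2_eq_iff lindblad_L1_def lindblad_L2_def dagger_def
      matrix_matrix_mult_def sum_2 complex_eq_iff)

lemma flow_op_conjugation:
  "flow_op \<sigma> m n ** \<rho> ** dagger (flow_op \<sigma> m n) =
     mat2 (\<rho> $ 1 $ 1) (cnj (\<sigma> (m - n)) * \<rho> $ 1 $ 2) (\<sigma> (m - n) * \<rho> $ 2 $ 1)
       (complex_of_real ((cmod (\<sigma> (m - n)))\<^sup>2) * \<rho> $ 2 $ 2)"
  unfolding complex_norm_square
  by (simp add: matrix_2_eq_iff flow_op_def dagger_def matrix_matrix_mult_def sum_2)

lemma scaleR_entry: "(r *\<^sub>R A) $ i $ j = complex_of_real r * A $ i $ j"
  unfolding vector_scaleR_component by (rule scaleR_conv_of_real)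

lemma picard_Suc_entries:
  assumes "T1 > 0" and "T2 > 0" and N: "N = 2 * p - 3"
  shows "picard p T1 T2 \<Delta>t \<sigma> \<rho> n (Suc k) $ 1 $ 1 =
      \<rho> n $ 1 $ 1
      + of_real (\<Delta>t / T1) * (\<Sum>j<N. of_real (gregory_weight p j) * \<rho> (n + j) $ 2 $ 2)
      + of_real (\<Delta>t / T1 * gregory_weight p N) * picard p T1 T2 \<Delta>t \<sigma> \<rho> n k $ 2 $ 2"
    and "picard p T1 T2 \<Delta>t \<sigma> \<rho> n (Suc k) $ 1 $ 2 = cnj (\<sigma> N) * \<rho> n $ 1 $ 2"
    and "picard p T1 T2 \<Delta>t \<sigma> \<rho> n (Suc k) $ 2 $ 1 = \<sigma> N * \<rho> n $ 2 $ 1"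
    and "picard p T1 T2 \<Delta>t \<sigma> \<rho> n (Suc k) $ 2 $ 2 =
      of_real ((cmod (\<sigma> N))\<^sup>2) * \<rho> n $ 2 $ 2
      + of_real (\<Delta>t / T2) *
          (\<Sum>j<N. of_real (gregory_weight p j * (cmod (\<sigma> (N - j)))\<^sup>2) * \<rho> (n + j) $ 2 $ 2)
      + of_real (gregory_weight p N * (\<Delta>t / T2)) * picard p T1 T2 \<Delta>t \<sigma> \<rho> n k $ 2 $ 2"
  unfolding N using assms(1,2)
  by (simp_all add: Let_def flow_op_conjugation jump_eq scaleR_entry sum_distrib_left mult_ac
      del: vector_scaleR_component)

text \<open>The Picard iteration for the entry \<open>(2, 2)\<close> is the scalar affine iteration
  $x \mapsto R + qx$ with $q = \omega_N\Delta t/T_2$, started from the newest known value.\<close>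

lemma picard_22:
  fixes \<Delta>t :: real
  assumes "T1 > 0" and "T2 > 0" and N: "N = 2 * p - 3"
  defines "q \<equiv> complex_of_real (gregory_weight p N * (\<Delta>t / T2))"
  shows "picard p T1 T2 \<Delta>t \<sigma> \<rho> n k $ 2 $ 2 =
      (\<Sum>i<k. q ^ i) *
        (of_real ((cmod (\<sigma> N))\<^sup>2) * \<rho> n $ 2 $ 2
         + of_real (\<Delta>t / T2) *
             (\<Sum>j<N. of_real (gregory_weight p j * (cmod (\<sigma> (N - j)))\<^sup>2) * \<rho> (n + j) $ 2 $ 2))
      + q ^ k * \<rho> (n + N - 1) $ 2 $ 2"
proof -
  define R where "R = of_real ((cmod (\<sigma> N))\<^sup>2) * \<rho> n $ 2 $ 2
      + of_real (\<Delta>t / T2) *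
          (\<Sum>j<N. of_real (gregory_weight p j * (cmod (\<sigma> (N - j)))\<^sup>2) * \<rho> (n + j) $ 2 $ 2)"
  have "picard p T1 T2 \<Delta>t \<sigma> \<rho> n k $ 2 $ 2 =
      (\<Sum>i<k. q ^ i) * R + q ^ k * \<rho> (n + N - 1) $ 2 $ 2"
  proof (induction k)
    case 0
    show ?case by (simp add: N)
  next
    case (Suc k)
    have "(\<Sum>i<Suc k. q ^ i) = 1 + q * (\<Sum>i<k. q ^ i)"
      by (simp only: sum.lessThan_Suc_shift sum_distrib_left power_Suc power_0)
    then show ?case
      unfolding picard_Suc_entries(4)[OF assms(1-3)] R_def[symmetric] q_def[symmetric] Suc.IH
      by (simp add: algebra_simps)
  qed
  then show ?thesis
    by (simp only: R_def)
qed

section \<open>Eigenvectors of the amplification matrix as windows\<close>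

text \<open>Scalars are complex, while the vector space structure of \<open>complex^2^2\<close> is real; complex
  multiples are therefore written \<open>mat c ** A\<close>.\<close>

lemma mat_mult_entry [simp]: "(mat c ** A) $ i $ j = c * A $ i $ j" for A :: "complex^2^2"
  using exhaust_2[of i] by (auto simp: matrix_matrix_mult_def mat_def sum_2)

lemma picard_linear:
  assumes "T1 > 0" and "T2 > 0"
  shows "picard p T1 T2 \<Delta>t \<sigma> (\<lambda>j. mat c ** \<rho> j + \<tau> j) n k =
      mat c ** picard p T1 T2 \<Delta>t \<sigma> \<rho> n k + picard p T1 T2 \<Delta>t \<sigma> \<tau> n k"
proof (induction k)
  case (Suc k)
  show ?case
    unfolding matrix_2_eq_iff vector_add_component mat_mult_entry
      picard_Suc_entries[OF assms refl] Suc.IH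
    by (simp add: algebra_simps sum.distrib sum_distrib_left)
qed simp

lemma scheme_step_linear:
  assumes "T1 > 0" and "T2 > 0"
  shows "scheme_step p T1 T2 \<Delta>t \<sigma> (\<lambda>j. mat c ** \<rho> j + \<tau> j) i =
      mat c ** scheme_step p T1 T2 \<Delta>t \<sigma> \<rho> i + scheme_step p T1 T2 \<Delta>t \<sigma> \<tau> i"
  by (simp add: scheme_step_def picard_linear[OF assms])

lemma linear_functional_unit_vec_expansion:
  fixes f :: "complex Matrix.vec \<Rightarrow> complex"
  assumes lin: "\<And>c v w. v \<in> carrier_vec n \<Longrightarrow> w \<in> carrier_vec n \<Longrightarrow>
      f (c \<cdot>\<^sub>v v + w) = c * f v + f w"
    and v: "v \<in> carrier_vec n"
  shows "f v = (\<Sum>c<n. vec_index v c * f (unit_vec n c))"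
proof -
  let ?u = "\<lambda>m. Matrix.vec n (\<lambda>i. if i < m then vec_index v i else 0)"
  have partial: "f (?u m) = (\<Sum>c<m. vec_index v c * f (unit_vec n c))" if "m \<le> n" for m
    using that
  proof (induction m)
    case 0
    have "f (0\<^sub>v n) = 0"
      using lin[of "0\<^sub>v n" "0\<^sub>v n" 1] by simp
    moreover have "?u 0 = 0\<^sub>v n" by auto
    ultimately show ?case by simp
  next
    case (Suc m)
    have "?u (Suc m) = vec_index v m \<cdot>\<^sub>v unit_vec n m + ?u m"
      using Suc.prems by (intro eq_vecI) (auto simp: unit_vec_def less_Suc_eq)
    then show ?case
      using Suc lin[of "unit_vec n m" "?u m" "vec_index v m"] by simp
  qed
  have "?u n = v"
    using v by auto
  then show ?thesis
    using partial[of n] by simp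
qed

lemma dim_vectorize [simp]: "dim_vec (vectorize N \<rho>) = 4 * N"
  by (simp add: vectorize_def)

lemma vectorize_cong:
  assumes "\<And>j. j < N \<Longrightarrow> \<rho> j = \<tau> j"
  shows "vectorize N \<rho> = vectorize N \<tau>"
  using assms by (auto simp: vectorize_def)

lemma vectorize_linear:
  "vectorize N (\<lambda>j. mat c ** \<rho> j + \<tau> j) = c \<cdot>\<^sub>v vectorize N \<rho> + vectorize N \<tau>"
  by (auto simp: vectorize_def)

lemma vectorize_index:
  assumes "b < N" and "t < 4"
  shows "vec_index (vectorize N \<rho>) (4 * b + t) = \<rho> (N - 1 - b) $ ix (t mod 2) $ ix (t div 2)"
proof -
  have "4 * b + t < 4 * N" "(4 * b + t) div 4 = b" "(4 * b + t) mod 4 = t"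
    "(4 * b + t) mod 2 = t mod 2"
    using assms by presburger+
  then show ?thesis
    unfolding vectorize_def by simp
qed

lemma unvectorize_vectorize:
  assumes "j < N"
  shows "unvectorize N (vectorize N \<rho>) j = \<rho> j"
proof -
  define b where "b = N - 1 - j"
  have b: "b < N" and j: "N - 1 - b = j"
    using assms by (auto simp: b_def)
  note index = vectorize_index[OF b, where \<rho> = \<rho>, unfolded j]
  show ?thesis
    unfolding matrix_2_eq_iff unvectorize_def Let_def b_def[symmetric] mat2_entries
    using index[of 0] index[of 1] index[of 2] index[of 3] by (simp add: ix_def)
qed

lemma vectorize_unvectorize:
  assumes "v \<in> carrier_vec (4 * N)"
  shows "vectorize N (unvectorize N v) = v"
proof (rule eq_vecI)
  fix r assume "r < dim_vec v"
  then have r: "r < 4 * N" using assms by simp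
  define b t where "b = r div 4" and "t = r mod 4"
  have b: "b < N" and t: "t < 4" and rbt: "r = 4 * b + t"
    using r by (auto simp: b_def t_def)
  have inv: "N - 1 - (N - 1 - b) = b" using b by simp
  have "vec_index (vectorize N (unvectorize N v)) r =
      mat2 (vec_index v (4 * b)) (vec_index v (4 * b + 2)) (vec_index v (4 * b + 1))
        (vec_index v (4 * b + 3)) $ ix (t mod 2) $ ix (t div 2)"
    unfolding rbt vectorize_index[OF b t] unvectorize_def Let_def inv ..
  moreover have "t = 0 \<or> t = 1 \<or> t = 2 \<or> t = 3" using t by arith
  ultimately show "vec_index (vectorize N (unvectorize N v)) r = vec_index v r"
    unfolding rbt by (elim disjE) (simp_all add: ix_def)
qed (use assms in \<open>simp add: vectorize_def\<close>)

text \<open>For \<open>j \<ge> N\<close> the truncated subtraction makes \<open>unvectorize N v j\<close> a copy of the matrix of index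
  \<open>N - 1\<close>, so linearity holds at every index.\<close>

lemma unvectorize_linear:
  assumes "v \<in> carrier_vec (4 * N)" and "w \<in> carrier_vec (4 * N)" and "N > 0"
  shows "unvectorize N (c \<cdot>\<^sub>v v + w) j = mat c ** unvectorize N v j + unvectorize N w j"
proof -
  have "4 * (N - 1 - j) + 3 < 4 * N" using assms(3) by simp
  then show ?thesis
    using assms(1,2) by (simp add: matrix_2_eq_iff unvectorize_def Let_def)
qed

lemma amplification_matrix_carrier:
  "amplification_matrix p T1 T2 \<Delta>t \<sigma> \<in> carrier_mat (4 * (2 * p - 3)) (4 * (2 * p - 3))"
  by (simp add: amplification_matrix_def Let_def mat_of_cols_def)

text \<open>The columns of the matrix are the images of the unit vectors, so by linearity it represents the
  step of the scheme on all windows.\<close>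

lemma amplification_matrix_mult_vec:
  assumes "2 \<le> p" and "T1 > 0" and "T2 > 0" and N: "N = 2 * p - 3"
    and v: "v \<in> carrier_vec (4 * N)"
  shows "amplification_matrix p T1 T2 \<Delta>t \<sigma> *\<^sub>v v =
      vectorize N (scheme_step p T1 T2 \<Delta>t \<sigma> (unvectorize N v))" (is "?A *\<^sub>v v = ?F v")
proof (rule eq_vecI)
  have N0: "N > 0" using assms(1) N by simp
  have lin: "?F (c \<cdot>\<^sub>v x + y) = c \<cdot>\<^sub>v ?F x + ?F y"
    if "x \<in> carrier_vec (4 * N)" "y \<in> carrier_vec (4 * N)" for c x y
  proof -
    have "unvectorize N (c \<cdot>\<^sub>v x + y) = (\<lambda>j. mat c ** unvectorize N x j + unvectorize N y j)"
      using that unvectorize_linear N0 by blast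
    then show ?thesis
      by (simp add: scheme_step_linear[OF assms(2,3)] vectorize_linear)
  qed
  fix r assume "r < dim_vec (?F v)"
  then have r: "r < 4 * N" by (simp add: vectorize_def)
  have entry: "?A $$ (r, c) = vec_index (?F (unit_vec (4 * N) c)) r" if "c < 4 * N" for c
    using r that by (simp add: amplification_matrix_def Let_def mat_of_cols_def N[symmetric])
  have "vec_index (?A *\<^sub>v v) r = (\<Sum>c<4 * N. ?A $$ (r, c) * vec_index v c)"
    using r v amplification_matrix_carrier[of p T1 T2 \<Delta>t \<sigma>] N
    by (auto simp: scalar_prod_def atLeast0LessThan intro!: sum.cong)
  also have "\<dots> = (\<Sum>c<4 * N. vec_index v c * vec_index (?F (unit_vec (4 * N) c)) r)"
    by (simp add: entry mult.commute)
  also have "\<dots> = vec_index (?F v) r"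
    by (rule linear_functional_unit_vec_expansion[symmetric])
      (use r v in \<open>simp_all add: lin\<close>)
  finally show "vec_index (?A *\<^sub>v v) r = vec_index (?F v) r" .
qed (use amplification_matrix_carrier[of p T1 T2 \<Delta>t \<sigma>] N in \<open>auto simp: vectorize_def\<close>)

text \<open>A step drops the oldest matrix and shifts the others, so the eigenvalue equation makes each
  matrix \<open>z\<close> times its predecessor; its newest component says the same of the matrix that the
  Picard iteration produces. With $0^0 = 1$ this also covers \<open>z = 0\<close>, where only the oldest
  matrix is nonzero.\<close>

lemma eigenvector_window:
  assumes "2 \<le> p" and "T1 > 0" and "T2 > 0" and N: "N = 2 * p - 3"
    and ev: "eigenvector (amplification_matrix p T1 T2 \<Delta>t \<sigma>) v z"
  defines "\<rho> \<equiv> unvectorize N v"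
  shows "\<And>j. j < N \<Longrightarrow> \<rho> j = mat (z ^ j) ** \<rho> 0"
    and "picard p T1 T2 \<Delta>t \<sigma> \<rho> 0 p = mat (z ^ N) ** \<rho> 0"
    and "\<rho> 0 \<noteq> 0"
proof -
  have N0: "N > 0" using assms(1) N by simp
  have v: "v \<in> carrier_vec (4 * N)" and v0: "v \<noteq> 0\<^sub>v (4 * N)"
    and eq: "amplification_matrix p T1 T2 \<Delta>t \<sigma> *\<^sub>v v = z \<cdot>\<^sub>v v"
    using ev amplification_matrix_carrier[of p T1 T2 \<Delta>t \<sigma>] N by (auto simp: eigenvector_def)
  have "vectorize N (scheme_step p T1 T2 \<Delta>t \<sigma> \<rho>) = z \<cdot>\<^sub>v v"
    using amplification_matrix_mult_vec[OF assms(1-4) v] eq by (simp add: \<rho>_def)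
  then have step: "scheme_step p T1 T2 \<Delta>t \<sigma> \<rho> j = mat z ** \<rho> j" if "j < N" for j
    using unvectorize_vectorize[OF that, of "scheme_step p T1 T2 \<Delta>t \<sigma> \<rho>"]
      unvectorize_linear[OF v zero_carrier_vec N0, of z j] v that
    by (simp add: \<rho>_def unvectorize_def[of N "0\<^sub>v (4 * N)"] Let_def matrix_2_eq_iff)
  show geo: "\<rho> j = mat (z ^ j) ** \<rho> 0" if "j < N" for j
    using that
  proof (induction j)
    case (Suc j)
    have "\<rho> (Suc j) = mat z ** \<rho> j"
      using step[of j] Suc.prems by (simp add: scheme_step_def N)
    then show ?case
      using Suc by (simp add: matrix_2_eq_iff)
  qed simp
  have "scheme_step p T1 T2 \<Delta>t \<sigma> \<rho> (N - 1) = picard p T1 T2 \<Delta>t \<sigma> \<rho> 0 p"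
    using N0 by (simp add: scheme_step_def flip: N)
  then have "picard p T1 T2 \<Delta>t \<sigma> \<rho> 0 p = mat z ** \<rho> (N - 1)"
    using step[of "N - 1"] N0 by simp
  moreover have "z ^ N = z * z ^ (N - 1)"
    using N0 by (simp add: power_eq_if)
  ultimately show "picard p T1 T2 \<Delta>t \<sigma> \<rho> 0 p = mat (z ^ N) ** \<rho> 0"
    using geo[of "N - 1"] N0 by (simp add: matrix_2_eq_iff)
  show "\<rho> 0 \<noteq> 0"
  proof
    assume "\<rho> 0 = 0"
    then have "\<rho> j = 0" if "j < N" for j
      using geo[OF that] by (simp add: matrix_2_eq_iff)
    then have "vectorize N \<rho> = vectorize N (\<lambda>_. 0)"
      by (intro vectorize_cong)
    then show False
      using vectorize_unvectorize[OF v] v0 by (auto simp: \<rho>_def vectorize_def)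
  qed
qed

section \<open>Eigenvalues lie in the unit disk\<close>

text \<open>Substituting \<open>j = N - k\<close> puts the polynomial into the shape of \<open>picard_22\<close> for the sequence
  $z^0, z^1, \dots$.\<close>

lemma poly_stability_poly:
  assumes N: "N = 2 * p - 3"
  shows "poly (stability_poly p T2 \<Delta>t \<sigma>) z =
      z ^ N
      - of_real (picard_factor p T2 \<Delta>t) *
          (of_real ((cmod (\<sigma> N))\<^sup>2)
           + of_real (\<Delta>t / T2) *
               (\<Sum>j<N. of_real (gregory_weight p j * (cmod (\<sigma> (N - j)))\<^sup>2) * z ^ j))
      - of_real (gregory_weight p N * (\<Delta>t / T2)) ^ p * z ^ (N - 1)"
proof -
  have "2 * p - 4 = N - 1" using N by simp
  moreover have "(\<Sum>k=1..N. g (N - k) k) = (\<Sum>j<N. g j (N - j))" for g :: "nat \<Rightarrow> nat \<Rightarrow> complex"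
    by (rule sum.reindex_bij_witness[of _ "\<lambda>j. N - j" "\<lambda>k. N - k"]) auto
  from this[of "\<lambda>j k. of_real (gregory_weight p j * picard_factor p T2 \<Delta>t * (\<Delta>t / T2) *
      (cmod (\<sigma> k))\<^sup>2) * z ^ j"]
  have "(\<Sum>k=1..N. of_real (gregory_weight p (N - k) * picard_factor p T2 \<Delta>t * (\<Delta>t / T2) *
      (cmod (\<sigma> k))\<^sup>2) * z ^ (N - k)) =
    of_real (picard_factor p T2 \<Delta>t) * of_real (\<Delta>t / T2) *
      (\<Sum>j<N. of_real (gregory_weight p j * (cmod (\<sigma> (N - j)))\<^sup>2) * z ^ j)"
    by (simp add: sum_distrib_left mult_ac)
  ultimately show ?thesis
    unfolding stability_poly_def N[symmetric] poly_diff poly_sum poly_monom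
    by (simp add: algebra_simps power_mult_distrib power_divide)
qed

lemma picard_factor_eq_sum:
  assumes "p > 0"
  shows "complex_of_real (picard_factor p T2 \<Delta>t) =
      (\<Sum>i<p. complex_of_real (gregory_weight p (2 * p - 3) * (\<Delta>t / T2)) ^ i)"
proof -
  have "{0..p - 1} = {..<p}" using assms by auto
  then show ?thesis
    by (simp add: picard_factor_def power_mult_distrib power_divide)
qed

lemma amplification_eigenvalue_in_unit_disk:
  assumes p: "2 \<le> p" and T: "T1 > 0" "T2 > 0"
    and roots: "\<And>z. poly (stability_poly p T2 \<Delta>t \<sigma>) z = 0 \<Longrightarrow> cmod z \<le> 1"
    and \<sigma>: "cmod (\<sigma> (2 * p - 3)) \<le> 1"
    and ev: "eigenvector (amplification_matrix p T1 T2 \<Delta>t \<sigma>) v z"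
  shows "cmod z \<le> 1"
proof -
  define N where "N = 2 * p - 3"
  define \<rho> where "\<rho> = unvectorize N v"
  note window = eigenvector_window[OF p T N_def ev, folded \<rho>_def]
  have N0: "N > 0" and pos: "p > 0" using p by (auto simp: N_def)
  define d where "d = \<rho> 0 $ 2 $ 2"
  have geo: "\<rho> j $ 2 $ 2 = z ^ j * d" if "j < N" for j
    unfolding d_def using window(1)[OF that] by (metis mat_mult_entry)
  show ?thesis
  proof (cases "d = 0")
    case False
    have "z ^ N * d = picard p T1 T2 \<Delta>t \<sigma> \<rho> 0 p $ 2 $ 2"
      by (simp add: window(2) d_def)
    also have "\<dots> = of_real (picard_factor p T2 \<Delta>t) *
          (of_real ((cmod (\<sigma> N))\<^sup>2) * d
           + of_real (\<Delta>t / T2) * (\<Sum>j<N. of_real (gregory_weight p j * (cmod (\<sigma> (N - j)))\<^sup>2) *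
               (z ^ j * d)))
        + of_real (gregory_weight p N * (\<Delta>t / T2)) ^ p * (z ^ (N - 1) * d)"
      unfolding picard_22[OF T N_def] picard_factor_eq_sum[OF pos] N_def[symmetric]
      using N0 by (simp add: geo)
    also have "\<dots> = (z ^ N - poly (stability_poly p T2 \<Delta>t \<sigma>) z) * d"
      unfolding poly_stability_poly[OF N_def]
      by (simp add: algebra_simps sum_distrib_left)
    finally have "poly (stability_poly p T2 \<Delta>t \<sigma>) z = 0"
      using False by simp
    then show ?thesis by (rule roots)
  next
    case True
    then have zero: "\<rho> j $ 2 $ 2 = 0" if "j < N" for j
      using geo[OF that] by simp
    have pic0: "picard p T1 T2 \<Delta>t \<sigma> \<rho> 0 k $ 2 $ 2 = 0" for k
      unfolding picard_22[OF T N_def] using N0 zero by simp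
    obtain k where k: "p = Suc k" using pos by (cases p) auto
    \<comment> \<open>Without population in the entry \<open>(2, 2)\<close>, one step multiplies each remaining entry
      by a constant of modulus at most 1.\<close>
    have "z ^ N * \<rho> 0 $ 1 $ 1 = \<rho> 0 $ 1 $ 1"
      and "z ^ N * \<rho> 0 $ 1 $ 2 = cnj (\<sigma> N) * \<rho> 0 $ 1 $ 2"
      and "z ^ N * \<rho> 0 $ 2 $ 1 = \<sigma> N * \<rho> 0 $ 2 $ 1"
      using window(2) picard_Suc_entries(1-3)[OF T N_def, of \<Delta>t \<sigma> \<rho> 0 k]
      by (simp_all add: k[symmetric] pic0 zero matrix_2_eq_iff)
    moreover have "\<rho> 0 $ 1 $ 1 \<noteq> 0 \<or> \<rho> 0 $ 1 $ 2 \<noteq> 0 \<or> \<rho> 0 $ 2 $ 1 \<noteq> 0"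
      using window(3) True by (auto simp: matrix_2_eq_iff d_def)
    ultimately have "z ^ N \<in> {1, cnj (\<sigma> N), \<sigma> N}" by auto
    then have "cmod z ^ N \<le> 1"
      using \<sigma> by (auto simp: norm_power[symmetric] N_def)
    then show ?thesis
      using N0 by (metis not_le one_less_power)
  qed
qed

theorem theorem5p2:
  fixes p :: nat and T1 T2 \<Delta>t \<Omega> :: real
    and s :: "nat \<Rightarrow> real \<Rightarrow> real \<Rightarrow> real \<Rightarrow> complex"
    and \<sigma> :: "nat \<Rightarrow> complex"
  assumes "2 \<le> p" and "p \<le> 9"
    and "T1 > 0" and "T2 > 0" and "\<Delta>t > 0"
    and "flow_approximation p s"
    and "\<And>k. \<sigma> k = s k (\<Delta>t * \<Omega>) (\<Delta>t / T1) (\<Delta>t / T2)"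
    and "\<And>z. poly (stability_poly p T2 \<Delta>t \<sigma>) z = 0 \<Longrightarrow> cmod z \<le> 1"
    and "cmod (\<sigma> (2 * p - 3)) \<le> 1"
  shows "scheme_stable p T1 T2 \<Delta>t \<sigma>"
proof -
  have "0 < 4 * (2 * p - 3)" using assms(1) by simp
  from spectral_radius_mem_max(1)[OF amplification_matrix_carrier this, of T1 T2 \<Delta>t \<sigma>]
  obtain v z where "eigenvector (amplification_matrix p T1 T2 \<Delta>t \<sigma>) v z"
    and "spectral_radius (amplification_matrix p T1 T2 \<Delta>t \<sigma>) = norm z"
    by (auto simp: spectrum_def eigenvalue_def)
  with amplification_eigenvalue_in_unit_disk[where \<Delta>t = \<Delta>t and \<sigma> = \<sigma>,
    OF assms(1,3,4,8,9)] show ?thesis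
    by (auto simp: scheme_stable_def)
qed

end
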